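(* For $n\ge 0$ define $$U_{n}(q,b,q):=\frac{(1-q^{4n+2})(q/b;q)_n(-b)^nq^{n(n-1)/2}}{q^n(1-b)(1-q^2)(bq;q)_n}\left(1+2\sum_{j=1}^{n}\frac{(b;q)_j}{(q/b;q)_j}b^{-j}q^{j(j+1)/2}\right),$$ and let $U_n(q,-b,q)$ be the expression obtained by replacing $b$ by $-b$ throughout. Put $$U_{1(n)}(q^2,b,q^2)=\tfrac{1}{2}U_{n}(q,b,q)+\tfrac{1}{2}U_{n}(q,-b,q),\qquad U_{2(n)}(q^2,b,q^2)=\frac{(-b^2)^nq^{n(n-2)}}{(-q;q)_{2n}(b^2;q^2)_{n+1}}.$$ Then $(U_{1(n)}(q^2,b,q^2),U_{2(n)}(q^2,b,q^2))$ is a Bailey pair with respect to $(q^2,q^2)$; that is, for all $n\ge 0$, $$U_{2(n)}(q^2,b,q^2)=\sum_{j=0}^{n}\frac{U_{1(j)}(q^2,b,q^2)}{(q^2;q^2)_{n-j}(q^4;q^2)_{n+j}}.$$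
   Context: Here $(z;q)_n=(1-z)(1-zq)\cdots(1-zq^{n-1})$ (with $(z;q)_0=1$), and likewise with base $q^2$. The parameter $q\in\mathbb{C}$ satisfies $0<|q|<1$, and $b\in\mathbb{C}$, $b\neq 0$, is such that no denominator occurring in the formulas vanishes. A pair of sequences $(\alpha_n(a,q),\beta_n(a,q))$ is a Bailey pair with respect to $(a,q)$ if $\beta_n(a,q)=\sum_{0\le j\le n}\frac{\alpha_j(a,q)}{(q;q)_{n-j}(aq;q)_{n+j}}$ for all $n\ge 0$; a Bailey pair with respect to $(q^2,q^2)$ is obtained by taking $a=q^2$ and base $q^2$ in place of $q$. *)

theory Defs
  imports Complex_Main
begin

definition qpoch :: "complex \<Rightarrow> complex \<Rightarrow> nat \<Rightarrow> complex" where
  "qpoch z q n = (\<Prod>k<n. 1 - z * q ^ k)"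

text \<open>Bailey pair with respect to \<open>(a, q)\<close>, where \<open>q\<close> is the base; the meaning is the
  intended one when no \<open>(q;q)\<^sub>m\<close> and no \<open>(aq;q)\<^sub>m\<close> vanishes.\<close>

definition bailey_pair ::
    "complex \<Rightarrow> complex \<Rightarrow> (nat \<Rightarrow> complex) \<Rightarrow> (nat \<Rightarrow> complex) \<Rightarrow> bool" where
  "bailey_pair a q \<alpha> \<beta> \<longleftrightarrow>
     (\<forall>n. \<beta> n = (\<Sum>j=0..n. \<alpha> j / (qpoch q q (n - j) * qpoch (a * q) q (n + j))))"

text \<open>\<open>U b q n\<close> is \<open>U\<^sub>n(q,b,q)\<close>. The sequences \<open>U1 b q\<close> and \<open>U2 b q\<close> are
  \<open>U\<^sub>1(q\<^sup>2,b,q\<^sup>2)\<close> and \<open>U\<^sub>2(q\<^sup>2,b,q\<^sup>2)\<close>: their argument here is \<open>q\<close>, not the base \<open>q\<^sup>2\<close>.\<close>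

definition U :: "complex \<Rightarrow> complex \<Rightarrow> nat \<Rightarrow> complex" where
  "U b q n =
     ((1 - q ^ (4 * n + 2)) * qpoch (q / b) q n * (- b) ^ n * q ^ (n * (n - 1) div 2))
     / (q ^ n * (1 - b) * (1 - q ^ 2) * qpoch (b * q) q n)
     * (1 + 2 * (\<Sum>j=1..n. qpoch b q j / qpoch (q / b) q j
                   * b powi (- int j) * q ^ (j * (j + 1) div 2)))"

definition U1 :: "complex \<Rightarrow> complex \<Rightarrow> nat \<Rightarrow> complex" where
  "U1 b q n = 1 / 2 * U b q n + 1 / 2 * U (- b) q n"

text \<open>The exponent \<open>n(n - 2)\<close> is \<open>-1\<close> for \<open>n = 1\<close>, hence an integer power.\<close>

definition U2 :: "complex \<Rightarrow> complex \<Rightarrow> nat \<Rightarrow> complex" where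
  "U2 b q n =
     ((- (b ^ 2)) ^ n * q powi (int n * (int n - 2)))
     / (qpoch (- q) q (2 * n) * qpoch (b ^ 2) (q ^ 2) (n + 1))"

end

theory Submission
  imports Defs
begin

text \<open>The proof is by creative telescoping. Up to a factor, \<open>U\<^sub>j(q,b,q)\<close> is a sequence \<open>V\<^sub>j\<close> with
  a first-order inhomogeneous recurrence in \<open>j\<close>. With a suitable rational certificate, the sum over
  \<open>j\<close> for \<open>n + 1\<close> and a multiple of the sum for \<open>n\<close> add up to a telescoping sum plus a sum of
  terms coming from the inhomogeneity. Averaging over \<open>b\<close> and \<open>-b\<close> keeps only the part of the
  certificate that is even in \<open>b\<close>, and for this part the remaining alternating sum telescopes
  and cancels the boundary term. So the left- and right-hand sides of the theorem satisfy the same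
  first-order recurrence in \<open>n\<close>.\<close>

section \<open>Finite q-shifted factorials\<close>

lemma qpoch_0 [simp]: "qpoch z q 0 = 1"
  by (simp add: qpoch_def)

lemma qpoch_Suc: "qpoch z q (Suc n) = qpoch z q n * (1 - z * q ^ n)"
  by (simp add: qpoch_def)

lemma qpoch_Suc_shift: "qpoch z q (Suc n) = (1 - z) * qpoch (z * q) q n"
  unfolding qpoch_def prod.lessThan_Suc_shift by (simp add: mult.assoc)

lemma qpoch_self_nonzero:
  assumes "norm q < 1"
  shows "qpoch q q n \<noteq> 0"
proof -
  have "q * q ^ k \<noteq> 1" for k
  proof
    assume "q * q ^ k = 1"
    then have "norm (q ^ Suc k) = 1" by simp
    moreover have "norm q ^ Suc k < 1"
      using assms by (simp add: power_less_one_iff del: power_Suc)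
    ultimately show False by (simp only: norm_power)
  qed
  then show ?thesis by (force simp: qpoch_def)
qed

section \<open>The first-order recurrence behind \<open>U\<close>\<close>

definition V :: "complex \<Rightarrow> complex \<Rightarrow> nat \<Rightarrow> complex" where
  "V b q n =
     (qpoch (q / b) q n * (- b) ^ n * q ^ (n * (n - 1) div 2))
     / (q ^ n * (1 - b) * qpoch (b * q) q n)
     * (1 + 2 * (\<Sum>j=1..n. qpoch b q j / qpoch (q / b) q j
                   * b powi (- int j) * q ^ (j * (j + 1) div 2)))"

lemma U_eq_V: "U b q n = (1 - q ^ (4 * n + 2)) / (1 - q ^ 2) * V b q n"
  by (simp add: U_def V_def mult_ac)

lemma V_0: "1 - b \<noteq> 0 \<Longrightarrow> (1 - b) * V b q 0 = 1"
  by (simp add: V_def)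

text \<open>\<open>V\<close> is a prefactor \<open>A\<close> times one plus twice a partial sum of
  \<open>t\<close>. The ratio of consecutive \<open>A\<close> gives the homogeneous part; the
  product of \<open>A\<close> with the new summand \<open>t\<close> collapses to a monomial in
  \<open>q\<close>, so the inhomogeneity does not involve \<open>b\<close>. This is why averaging
  over b and -b works later.\<close>

lemma V_Suc:
  assumes "q \<noteq> 0" "b \<noteq> 0" "1 - b \<noteq> 0"
    and bq: "\<And>n. qpoch (b * q) q n \<noteq> 0" and qb: "\<And>n. qpoch (q / b) q n \<noteq> 0"
  shows "(1 - b * (q * q ^ n)) * V b q (Suc n) =
    (q ^ n)\<^sup>2 * (1 - b / (q * q ^ n)) * V b q n - 2 * (- 1) ^ n * q ^ (n * (n + 1))"
proof -
  define A where "A n = (qpoch (q / b) q n * (- b) ^ n * q ^ (n * (n - 1) div 2))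
     / (q ^ n * (1 - b) * qpoch (b * q) q n)" for n
  define t where "t j = qpoch b q j / qpoch (q / b) q j
                   * b powi (- int j) * q ^ (j * (j + 1) div 2)" for j
  have V: "V b q n = A n * (1 + 2 * (\<Sum>j=1..n. t j))" for n
    by (simp add: V_def A_def t_def)
  have nz: "1 - b * (q * q ^ n) \<noteq> 0"
    using bq[of "Suc n"] by (simp add: qpoch_Suc mult.assoc)
  have tri: "Suc n * (Suc n - 1) div 2 = n * (n - 1) div 2 + n"
  proof -
    have "Suc n * (Suc n - 1) = n * (n - 1) + 2 * n"
      by (cases n) (auto simp: algebra_simps)
    then show ?thesis by simp
  qed
  \<comment> \<open>Uses -b (1 - q^(n+1)/b) = q^(n+1) (1 - b/q^(n+1)).\<close>
  have A_Suc: "(1 - b * (q * q ^ n)) * A (Suc n) = (q ^ n)\<^sup>2 * (1 - b / (q * q ^ n)) * A n"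
    unfolding A_def tri qpoch_Suc power_add using nz bq[of n] assms(1-3)
    by (simp add: divide_simps mult.assoc) (simp add: algebra_simps power2_eq_square)
  have tri2: "Suc n * (Suc n - 1) div 2 + Suc n * (Suc n + 1) div 2 = n * (n + 1) + Suc n"
  proof -
    have "Suc n * (Suc n - 1) div 2 + Suc n * (Suc n + 1) div 2
        = (Suc n * (Suc n - 1) + Suc n * (Suc n + 1)) div 2"
      by (rule div_plus_div_distrib_dvd_left[symmetric]) simp
    also have "Suc n * (Suc n - 1) + Suc n * (Suc n + 1) = 2 * (n * (n + 1) + Suc n)"
      by (simp add: algebra_simps)
    finally show ?thesis by simp
  qed
  have pw: "(- b) ^ Suc n * b powi (- int (Suc n)) = (- 1) ^ Suc n"
    using assms(2) by (simp add: power_int_minus power_minus[of b] field_simps del: of_nat_Suc)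
  have "(1 - b * (q * q ^ n)) * (A (Suc n) * t (Suc n)) =
      ((- b) ^ Suc n * b powi (- int (Suc n)))
      * (q ^ (Suc n * (Suc n - 1) div 2 + Suc n * (Suc n + 1) div 2)) / q ^ Suc n
      * ((qpoch b q (Suc n) * (1 - b * (q * q ^ n))) / ((1 - b) * qpoch (b * q) q (Suc n)))"
    unfolding A_def t_def power_add using qb[of "Suc n"] by simp
  also have "(qpoch b q (Suc n) * (1 - b * (q * q ^ n))) / ((1 - b) * qpoch (b * q) q (Suc n)) = 1"
    using nz bq[of n] assms(3) unfolding qpoch_Suc_shift[of b q] qpoch_Suc[of "b * q"]
    by (simp add: mult.assoc)
  finally have At: "(1 - b * (q * q ^ n)) * (A (Suc n) * t (Suc n)) = (- 1) ^ Suc n * q ^ (n * (n + 1))"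
    unfolding pw tri2 power_add using assms(1) by simp
  have "(1 - b * (q * q ^ n)) * V b q (Suc n) =
      ((1 - b * (q * q ^ n)) * A (Suc n)) * (1 + 2 * (\<Sum>j=1..n. t j))
      + 2 * ((1 - b * (q * q ^ n)) * (A (Suc n) * t (Suc n)))"
    by (simp add: V algebra_simps)
  then show ?thesis
    unfolding A_Suc At V by (simp add: algebra_simps add_divide_distrib)
qed

text \<open>The Bailey kernel for a equal to the base, divided by 1 - q. In base q^2 this extra
  factor is the 1 - q^2 in the denominator of \<open>U\<close>.\<close>

definition bailey_coeff :: "complex \<Rightarrow> nat \<Rightarrow> nat \<Rightarrow> complex" where
  "bailey_coeff q m j = 1 / (qpoch q q (m - j) * qpoch q q (m + 1 + j))"

text \<open>At j = m the truncated subtraction leaves the left side nonzero while the right side is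
  0. The telescoping sums below therefore treat their top term separately.\<close>

lemma bailey_coeff_Suc_right:
  assumes "\<And>n. qpoch q q n \<noteq> 0" "j < m"
  shows "bailey_coeff q m (Suc j) * (1 - q ^ (m + 2 + j)) =
    bailey_coeff q m j * (1 - q ^ (m - j))"
proof -
  have e: "m - j = Suc (m - Suc j)" "m + 1 + Suc j = Suc (m + 1 + j)" using assms(2) by auto
  have nz: "1 - q * q ^ k \<noteq> 0" for k
    using assms(1)[of "Suc k"] by (simp add: qpoch_Suc)
  show ?thesis
    unfolding bailey_coeff_def e qpoch_Suc
    using assms(1) nz[of "m + 1 + j"] nz[of "m - Suc j"] by (simp add: divide_simps)
qed

lemma bailey_coeff_Suc_left:
  assumes "\<And>n. qpoch q q n \<noteq> 0" "j \<le> m"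
  shows "bailey_coeff q (Suc m) j * ((1 - q ^ (Suc m - j)) * (1 - q ^ (Suc m + 1 + j))) =
    bailey_coeff q m j"
proof -
  have e: "Suc m - j = Suc (m - j)" "Suc m + 1 + j = Suc (m + 1 + j)" using assms(2) by auto
  have nz: "1 - q * q ^ k \<noteq> 0" for k
    using assms(1)[of "Suc k"] by (simp add: qpoch_Suc)
  show ?thesis
    unfolding bailey_coeff_def e qpoch_Suc
    using assms(1) nz[of "m + 1 + j"] nz[of "m - j"] by (simp add: divide_simps)
qed

lemma square_power_diff:
  fixes q :: "'a::field"
  assumes "q \<noteq> 0" "j \<le> m"
  shows "(q\<^sup>2) ^ (m - j) = (q ^ m)\<^sup>2 / (q ^ j)\<^sup>2"
proof -
  have "(q\<^sup>2) ^ k = (q ^ k)\<^sup>2" for k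
    by (simp add: mult.commute flip: power_mult)
  then show ?thesis using assms by (simp add: power_diff power_divide)
qed

text \<open>An indefinite summation: the summand is \<open>L j - L (Suc j)\<close> with
  \<open>L m = 0\<close>, so only \<open>L 0\<close> remains. It evaluates the contribution of the
  part of the certificate that is even in b.\<close>

lemma alternating_bailey_coeff_sum:
  fixes q :: complex
  assumes q: "q \<noteq> 0" "\<And>n. qpoch (q\<^sup>2) (q\<^sup>2) n \<noteq> 0" and "0 < m"
  defines "u \<equiv> bailey_coeff (q\<^sup>2) m" and "M \<equiv> (q ^ m)\<^sup>2"
  shows "(\<Sum>j\<le>m. (- 1) ^ j * q ^ (j * (j + 1)) * u j * (1 - M / (q ^ j)\<^sup>2) * (1 + (q * q ^ j)\<^sup>2))
    = u 0 * (1 - M * q\<^sup>2)"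
proof -
  define f where "f j = (- 1) ^ j * q ^ (j * (j + 1)) * u j * (1 - M / (q ^ j)\<^sup>2) * (1 + (q * q ^ j)\<^sup>2)" for j
  define L where "L j = (- 1) ^ j * q ^ (j * (j + 1)) * u j * (1 - M * q\<^sup>2 * (q ^ j)\<^sup>2)
    * (1 - M / (q ^ j)\<^sup>2) / (1 - M)" for j
  have M1: "1 - M \<noteq> 0"
  proof -
    have "M = (q\<^sup>2) ^ m" by (simp add: M_def mult.commute flip: power_mult)
    then show ?thesis
      using q(2)[of m] \<open>0 < m\<close> by (cases m) (auto simp: qpoch_Suc)
  qed
  have step: "f j = L j - L (Suc j)" if "j < m" for j
  proof -
    define x where "x = q ^ j"
    have x: "x \<noteq> 0" using q(1) by (simp add: x_def)
    have "(q\<^sup>2) ^ (m - j) = M / x\<^sup>2"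
      unfolding M_def x_def using q(1) that by (intro square_power_diff) auto
    moreover have "(q\<^sup>2) ^ (m + 2 + j) = M * q ^ 4 * x\<^sup>2"
      by (simp add: M_def x_def power_add power_mult_distrib power2_eq_square power4_eq_xxxx mult_ac)
    ultimately have u: "u (Suc j) * (1 - M * q ^ 4 * x\<^sup>2) = u j * (1 - M / x\<^sup>2)"
      using bailey_coeff_Suc_right[OF q(2) that] by (simp only: u_def)
    have qq: "q ^ (Suc j * (Suc j + 1)) = q ^ (j * (j + 1)) * q\<^sup>2 * x\<^sup>2"
      by (simp add: x_def algebra_simps power2_eq_square power_add flip: power_mult)
    have e: "M * q\<^sup>2 * (q * x)\<^sup>2 = M * q ^ 4 * x\<^sup>2"
      by (simp add: power2_eq_square power4_eq_xxxx)
    have "L (Suc j) = - 1 * (- 1) ^ j * q ^ (j * (j + 1)) * q\<^sup>2 * x\<^sup>2 *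
        (u (Suc j) * (1 - M * q ^ 4 * x\<^sup>2)) * (1 - M / (q * x)\<^sup>2) / (1 - M)"
      unfolding L_def qq power_Suc x_def[symmetric] e by (simp only: mult_ac)
    also have "\<dots> = - ((- 1) ^ j * q ^ (j * (j + 1)) * u j * q\<^sup>2 * x\<^sup>2 *
        ((1 - M / x\<^sup>2)) * (1 - M / (q * x)\<^sup>2) / (1 - M))"
      unfolding u by (simp add: mult_ac)
    finally have LS: "L (Suc j) = \<dots>" .
    \<comment> \<open>What remains of \<open>f j = L j - L (Suc j)\<close>, times 1 - M, once the
      common factor is removed and \<open>u (Suc j)\<close> is expressed by
      \<open>u j\<close>.\<close>
    have key: "(1 - M / x\<^sup>2) * (1 + (q * x)\<^sup>2) * (1 - M) = (1 - M * q\<^sup>2 * x\<^sup>2) * (1 - M / x\<^sup>2)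
       + q\<^sup>2 * x\<^sup>2 * (1 - M / x\<^sup>2) * (1 - M / (q * x)\<^sup>2)"
      using x q(1) by (simp add: divide_simps) algebra
    have key': "(1 - M / x\<^sup>2) * (1 + (q * x)\<^sup>2) = ((1 - M * q\<^sup>2 * x\<^sup>2) * (1 - M / x\<^sup>2)
       + q\<^sup>2 * x\<^sup>2 * (1 - M / x\<^sup>2) * (1 - M / (q * x)\<^sup>2)) / (1 - M)"
      using M1 by (subst key[symmetric]) simp
    have "f j = (- 1) ^ j * q ^ (j * (j + 1)) * u j * ((1 - M / x\<^sup>2) * (1 + (q * x)\<^sup>2))"
      by (simp add: f_def x_def)
    also have "\<dots> = L j - L (Suc j)"
      unfolding key' LS by (simp add: L_def x_def[symmetric] ring_distribs add_divide_distrib mult_ac)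
    finally show ?thesis .
  qed
  have "(\<Sum>j\<le>m. f j) = (\<Sum>j<m. f j) + f m"
    by (simp add: lessThan_Suc_atMost[symmetric])
  also have "f m = 0" using q(1) by (simp add: f_def M_def)
  also have "(\<Sum>j<m. f j) = (\<Sum>j<m. L j - L (Suc j))"
    by (intro sum.cong) (auto simp: step)
  also have "\<dots> = L 0 - L m" by (rule sum_lessThan_telescope')
  also have "L m = 0" using q(1) by (simp add: L_def M_def)
  finally show ?thesis using M1 by (simp add: f_def L_def)
qed

text \<open>The certificate is the solution, as a Laurent polynomial in \<open>x = q\<^sup>j\<close>, of the equation in
  \<open>cert_identity\<close>; there \<open>M = q\<^bsup>2m\<^esup>\<close>.\<close>

definition cert :: "complex \<Rightarrow> complex \<Rightarrow> complex \<Rightarrow> complex \<Rightarrow> complex" where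
  "cert b q M x =
    - b * M * (x ^ 3 + 1 / x) - (q + M) * (x\<^sup>2 + 1) + b * (1 - q - M * (1 + q)) * x"

text \<open>With x = q^j, the first factors on the left come from the shift j to j + 1 of the kernel
  and of the homogeneous part of \<open>V_Suc\<close>. On the right, (1 - M/x^2)(1 - M x^2 q^2)
  turns the kernel for m into the one for m - 1, by \<open>bailey_coeff_Suc_left\<close>.\<close>

lemma cert_identity:
  assumes "q \<noteq> 0" "x \<noteq> 0"
  shows "(1 - M / x\<^sup>2) * (x\<^sup>2 * (1 - b / (q * x))) * cert b q M (q * x)
      - (1 - M * x\<^sup>2 * q\<^sup>2) * (1 - b * x) * cert b q M x
    = (1 - x ^ 4 * q\<^sup>2) * ((q + M) * (1 + M) * (1 - b\<^sup>2 * M)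
        + b\<^sup>2 * M / q\<^sup>2 * ((1 - M / x\<^sup>2) * (1 - M * x\<^sup>2 * q\<^sup>2)))"
  unfolding cert_def using assms
  by (simp add: divide_simps) algebra

section \<open>Recurrence in n for the Bailey sums\<close>

definition bailey_sum :: "complex \<Rightarrow> complex \<Rightarrow> nat \<Rightarrow> complex" where
  "bailey_sum b q m = (\<Sum>j\<le>m. (1 - q ^ (4 * j + 2)) * bailey_coeff (q\<^sup>2) m j * V b q j)"

text \<open>Multiply \<open>cert_identity\<close> by \<open>u j * V b q j\<close> and sum over j.
  The homogeneous part of \<open>V_Suc\<close> telescopes, its inhomogeneity gives the sum on the
  right, and the lower boundary gives the last term.\<close>

lemma bailey_sum_recurrence:
  fixes n :: nat
  assumes "q \<noteq> 0" "b \<noteq> 0" "1 - b \<noteq> 0"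
    and bq: "\<And>n. qpoch (b * q) q n \<noteq> 0" and qb: "\<And>n. qpoch (q / b) q n \<noteq> 0"
    and qq: "\<And>n. qpoch (q\<^sup>2) (q\<^sup>2) n \<noteq> 0"
  defines "u \<equiv> bailey_coeff (q\<^sup>2) (Suc n)" and "M \<equiv> (q ^ Suc n)\<^sup>2"
  shows "(q + M) * (1 + M) * (1 - b\<^sup>2 * M) * bailey_sum b q (Suc n) + b\<^sup>2 * M / q\<^sup>2 * bailey_sum b q n
    = 2 * (\<Sum>j\<le>Suc n. (- 1) ^ j * q ^ (j * (j + 1)) * u j * (1 - M / (q ^ j)\<^sup>2)
              * cert b q M (q * q ^ j))
      - u 0 * (1 - M * q\<^sup>2) * cert b q M 1"
proof -
  define m where "m = Suc n"
  define D where "D = (q + M) * (1 + M) * (1 - b\<^sup>2 * M)"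
  \<comment> \<open>\<open>H\<close> is the telescoping quantity, \<open>I\<close> the contribution
    of the inhomogeneity of \<open>V_Suc\<close>, and \<open>F\<close> the summand of the left side
    written with the kernel for n + 1 only.\<close>
  define H where "H j = u j * (1 - M * (q ^ j)\<^sup>2 * q\<^sup>2) * (1 - b * q ^ j) * cert b q M (q ^ j) * V b q j" for j
  define I where "I j = 2 * ((- 1) ^ j * q ^ (j * (j + 1)) * u j * (1 - M / (q ^ j)\<^sup>2)
              * cert b q M (q * q ^ j))" for j
  define F where "F j = (1 - q ^ (4 * j + 2)) * u j * V b q j *
     (D + b\<^sup>2 * M / q\<^sup>2 * ((1 - M / (q ^ j)\<^sup>2) * (1 - M * (q ^ j)\<^sup>2 * q\<^sup>2)))" for j
  have F: "F j = u j * (1 - M / (q ^ j)\<^sup>2) * ((q ^ j)\<^sup>2 * (1 - b / (q * q ^ j)) * V b q j)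
      * cert b q M (q * q ^ j) - H j" for j
  proof -
    define x where "x = q ^ j"
    have x: "x \<noteq> 0" using assms(1) by (simp add: x_def)
    have "q ^ (4 * j + 2) = x ^ 4 * q\<^sup>2"
      unfolding x_def power_add by (simp add: mult.commute flip: power_mult)
    then have "F j = u j * V b q j * ((1 - x ^ 4 * q\<^sup>2) * (D
        + b\<^sup>2 * M / q\<^sup>2 * ((1 - M / x\<^sup>2) * (1 - M * x\<^sup>2 * q\<^sup>2))))"
      by (simp add: F_def x_def mult_ac)
    then show ?thesis
      unfolding D_def cert_identity[OF assms(1) x, of M b, symmetric]
      by (simp only: H_def x_def right_diff_distrib mult_ac)
  qed
  have step: "F j = H (Suc j) + I j - H j" if "j < m" for j
  proof -
    have "(q\<^sup>2) ^ (m - j) = M / (q ^ j)\<^sup>2"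
      unfolding M_def m_def[symmetric] using assms(1) that by (intro square_power_diff) auto
    moreover have "(q\<^sup>2) ^ (m + 2 + j) = M * (q ^ Suc j)\<^sup>2 * q\<^sup>2"
      by (simp add: M_def m_def[symmetric] power_add power_mult_distrib power2_eq_square mult_ac)
    ultimately have u: "u (Suc j) * (1 - M * (q ^ Suc j)\<^sup>2 * q\<^sup>2) = u j * (1 - M / (q ^ j)\<^sup>2)"
      using bailey_coeff_Suc_right[OF qq that] by (simp only: u_def m_def)
    have V: "(q ^ j)\<^sup>2 * (1 - b / (q * q ^ j)) * V b q j
      = (1 - b * (q * q ^ j)) * V b q (Suc j) + 2 * (- 1) ^ j * q ^ (j * (j + 1))"
      using V_Suc[OF assms(1-3) bq qb, of j] by simp
    show ?thesis
      unfolding F V H_def[of "Suc j"] u by (simp only: I_def power_Suc distrib_left distrib_right mult_ac)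
  qed
  have "q ^ m \<noteq> 0" using assms(1) by simp
  \<comment> \<open>Since M = (q^m)^2, the factor 1 - M/(q^m)^2 vanishes and \<open>I m\<close> is
    0; including it lets the sum of \<open>I\<close> run up to m.\<close>
  then have last: "F m = I m - H m"
    unfolding F using assms(1) by (simp add: I_def M_def m_def[symmetric])
  have "(\<Sum>j\<le>m. F j) = (\<Sum>j<m. F j) + F m"
    by (simp add: lessThan_Suc_atMost[symmetric])
  also have "(\<Sum>j<m. F j) = (\<Sum>j<m. H (Suc j) - H j + I j)"
    by (intro sum.cong) (auto simp: step)
  also have "\<dots> = H m - H 0 + (\<Sum>j<m. I j)"
    by (simp add: sum.distrib sum_lessThan_telescope)
  finally have "(\<Sum>j\<le>m. F j) = (\<Sum>j\<le>m. I j) - H 0"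
    by (simp add: last lessThan_Suc_atMost[symmetric])
  moreover have "H 0 = u 0 * (1 - M * q\<^sup>2) * cert b q M 1"
    using V_0[OF assms(3), of q] by (simp add: H_def mult_ac)
  moreover have "(\<Sum>j\<le>m. F j) = D * bailey_sum b q m + b\<^sup>2 * M / q\<^sup>2 * bailey_sum b q n"
  proof -
    have low: "u j * ((1 - M / (q ^ j)\<^sup>2) * (1 - M * (q ^ j)\<^sup>2 * q\<^sup>2)) = bailey_coeff (q\<^sup>2) n j"
      if "j \<le> n" for j
    proof -
      have "(q\<^sup>2) ^ (m - j) = M / (q ^ j)\<^sup>2"
        unfolding M_def m_def using assms(1) that by (intro square_power_diff) auto
      moreover have "(q\<^sup>2) ^ (m + 1 + j) = M * (q ^ j)\<^sup>2 * q\<^sup>2"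
        by (simp add: M_def m_def[symmetric] power_add flip: power_mult) (simp add: mult.commute)
      ultimately show ?thesis
        using bailey_coeff_Suc_left[OF qq that] by (simp add: u_def m_def)
    qed
    have "bailey_sum b q n = (\<Sum>j\<le>n. (1 - q ^ (4 * j + 2)) * V b q j *
        (u j * ((1 - M / (q ^ j)\<^sup>2) * (1 - M * (q ^ j)\<^sup>2 * q\<^sup>2))))"
      unfolding bailey_sum_def by (intro sum.cong) (auto simp: low)
    \<comment> \<open>The added summand j = m contains 1 - M/(q^m)^2 = 0.\<close>
    also have "\<dots> = (\<Sum>j\<le>m. (1 - q ^ (4 * j + 2)) * V b q j *
        (u j * ((1 - M / (q ^ j)\<^sup>2) * (1 - M * (q ^ j)\<^sup>2 * q\<^sup>2))))"
      using \<open>q ^ m \<noteq> 0\<close> unfolding m_def by (simp add: M_def)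
    finally have "bailey_sum b q n = \<dots>" .
    then show ?thesis
      unfolding bailey_sum_def[of b q m]
      by (simp only: F_def u_def m_def[symmetric] sum_distrib_left distrib_left sum.distrib mult_ac)
  qed
  ultimately show ?thesis
    by (simp add: D_def I_def m_def sum_distrib_left)
qed

text \<open>The terms odd in b cancel. At x = q^(j+1) the factor 1 + x^2 is the one in
  \<open>alternating_bailey_coeff_sum\<close>.\<close>

lemma cert_even: "cert b q M x + cert (- b) q M x = - 2 * (q + M) * (1 + x\<^sup>2)"
  by (simp add: cert_def algebra_simps)

section \<open>The closed form and the Bailey pair\<close>

lemma U2_Suc:
  fixes n :: nat
  assumes "q \<noteq> 0" "\<And>n. qpoch (- q) q n \<noteq> 0" "\<And>n. qpoch (b\<^sup>2) (q\<^sup>2) (n + 1) \<noteq> 0"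
  defines "M \<equiv> (q ^ Suc n)\<^sup>2"
  shows "(q + M) * (1 + M) * (1 - b\<^sup>2 * M) * U2 b q (Suc n) = - (b\<^sup>2 * M / q\<^sup>2 * U2 b q n)"
proof -
  have "int (Suc n) * (int (Suc n) - 2) = int n * (int n - 2) + (2 * int n - 1)"
    by (simp add: algebra_simps)
  moreover have "q powi (2 * int n - 1) = q ^ (2 * n) / q"
    using assms(1) power_int_diff[of q "int (2 * n)" 1]
    by (simp only: power_int_of_nat power_int_1_right) simp
  ultimately have pw: "q powi (int (Suc n) * (int (Suc n) - 2))
      = q powi (int n * (int n - 2)) * (q ^ (2 * n) / q)"
    using assms(1) by (simp only: power_int_add[OF disjI1[OF assms(1)]])
  define X where "X = q ^ (2 * n)"
  have MX: "M = q\<^sup>2 * X"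
    by (simp add: M_def X_def power_mult_distrib flip: power_mult) (simp add: mult.commute)
  have p1: "qpoch (- q) q (2 * Suc n) = qpoch (- q) q (2 * n) * (1 + q * X) * (1 + q * (q * X))"
    by (simp add: qpoch_Suc X_def)
  have p2: "qpoch (b\<^sup>2) (q\<^sup>2) (Suc n + 1) = qpoch (b\<^sup>2) (q\<^sup>2) (n + 1) * (1 - b\<^sup>2 * (q\<^sup>2 * X))"
    by (simp add: qpoch_Suc X_def mult.assoc flip: power_mult)
  have n1: "1 + q * X \<noteq> 0" "1 + q * (q * X) \<noteq> 0" "1 - b\<^sup>2 * (q\<^sup>2 * X) \<noteq> 0"
    using assms(2)[of "2 * Suc n"] assms(3)[of "Suc n"] unfolding p1 p2 by simp_all
  show ?thesis
    unfolding U2_def pw p1 p2 MX X_def[symmetric]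
    using n1 assms(1) assms(2)[of "2 * n"] assms(3)[of n]
    by (simp add: divide_simps) (simp add: algebra_simps power2_eq_square)
qed

theorem lemma2p4:
  fixes q b :: complex
  assumes "0 < norm q" and "norm q < 1" and "b \<noteq> 0"
    and "1 - b \<noteq> 0" and "1 - (- b) \<noteq> 0"
    and "\<And>n. qpoch (b * q) q n \<noteq> 0" and "\<And>n. qpoch (- b * q) q n \<noteq> 0"
    and "\<And>n. qpoch (q / b) q n \<noteq> 0" and "\<And>n. qpoch (q / (- b)) q n \<noteq> 0"
    and "\<And>n. qpoch (b ^ 2) (q ^ 2) (n + 1) \<noteq> 0"
  shows "bailey_pair (q ^ 2) (q ^ 2) (U1 b q) (U2 b q)"
proof -
  have q: "q \<noteq> 0" using assms(1) by simp
  have q2: "norm (q\<^sup>2) < 1"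
    using assms(2) by (simp add: norm_power power_less_one_iff)
  have qq: "qpoch (q\<^sup>2) (q\<^sup>2) n \<noteq> 0" for n
    using q2 by (rule qpoch_self_nonzero)
  have mq: "qpoch (- q) q n \<noteq> 0" for n
  proof -
    have "1 + q * q ^ k \<noteq> 0" for k
    proof
      assume "1 + q * q ^ k = 0"
      then have "q ^ Suc k = - 1" by (simp add: add_eq_0_iff)
      then have "norm q ^ Suc k = 1" by (metis norm_minus_cancel norm_one norm_power)
      then show False
        using power_Suc_less_one[of "norm q" k] assms(1,2) by simp
    qed
    then show ?thesis by (simp add: qpoch_def)
  qed
  have one: "1 - q\<^sup>2 \<noteq> 0" using qq[of 1] by (simp add: qpoch_def)
  have rec: "(q + M) * (1 + M) * (1 - b\<^sup>2 * M) * (bailey_sum b q (Suc n) + bailey_sum (- b) q (Suc n))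
      = - (b\<^sup>2 * M / q\<^sup>2 * (bailey_sum b q n + bailey_sum (- b) q n))" if "M = (q ^ Suc n)\<^sup>2" for M n
  proof -
    define u where "u = bailey_coeff (q\<^sup>2) (Suc n)"
    define s where "s j = (- 1) ^ j * q ^ (j * (j + 1)) * u j * (1 - M / (q ^ j)\<^sup>2)" for j
    have alt: "(\<Sum>j\<le>Suc n. s j * (1 + (q * q ^ j)\<^sup>2)) = u 0 * (1 - M * q\<^sup>2)"
      unfolding s_def u_def that by (rule alternating_bailey_coeff_sum[OF q qq]) simp
    have "(\<Sum>j\<le>Suc n. s j * cert b q M (q * q ^ j)) + (\<Sum>j\<le>Suc n. s j * cert (- b) q M (q * q ^ j))
        = (\<Sum>j\<le>Suc n. s j * (cert b q M (q * q ^ j) + cert (- b) q M (q * q ^ j)))"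
      by (simp only: sum.distrib distrib_left)
    also have "\<dots> = - 2 * (q + M) * (\<Sum>j\<le>Suc n. s j * (1 + (q * q ^ j)\<^sup>2))"
      unfolding cert_even by (simp only: sum_distrib_left mult_ac)
    finally have sum: "(\<Sum>j\<le>Suc n. s j * cert b q M (q * q ^ j))
        + (\<Sum>j\<le>Suc n. s j * cert (- b) q M (q * q ^ j)) = - 2 * (q + M) * (u 0 * (1 - M * q\<^sup>2))"
      unfolding alt .
    \<comment> \<open>The multipliers depend on b only through b^2, so the recurrences for b and -b
      can be added.\<close>
    have "(q + M) * (1 + M) * (1 - b\<^sup>2 * M) * (bailey_sum b q (Suc n) + bailey_sum (- b) q (Suc n))
        + b\<^sup>2 * M / q\<^sup>2 * (bailey_sum b q n + bailey_sum (- b) q n)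
      = ((q + M) * (1 + M) * (1 - b\<^sup>2 * M) * bailey_sum b q (Suc n) + b\<^sup>2 * M / q\<^sup>2 * bailey_sum b q n)
        + ((q + M) * (1 + M) * (1 - (- b)\<^sup>2 * M) * bailey_sum (- b) q (Suc n)
          + (- b)\<^sup>2 * M / q\<^sup>2 * bailey_sum (- b) q n)"
      by (simp add: ring_distribs add_divide_distrib)
    also have "\<dots> = 2 * (\<Sum>j\<le>Suc n. s j * cert b q M (q * q ^ j)) - u 0 * (1 - M * q\<^sup>2) * cert b q M 1
        + (2 * (\<Sum>j\<le>Suc n. s j * cert (- b) q M (q * q ^ j))
          - u 0 * (1 - M * q\<^sup>2) * cert (- b) q M 1)"
      unfolding that u_def s_def
      using bailey_sum_recurrence[OF q assms(3,4,6,8) qq, of n]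
        bailey_sum_recurrence[OF q _ assms(5,7,9) qq, of n] assms(3)
      by (simp only: neg_equal_0_iff_equal not_False_eq_True simp_thms)
    also have "\<dots> = 2 * ((\<Sum>j\<le>Suc n. s j * cert b q M (q * q ^ j))
          + (\<Sum>j\<le>Suc n. s j * cert (- b) q M (q * q ^ j)))
        - u 0 * (1 - M * q\<^sup>2) * (cert b q M 1 + cert (- b) q M 1)"
      by (simp only: ring_distribs) simp
    \<comment> \<open>Both parts equal -4 (q + M) u_0 (1 - M q^2): the factor 1 + x^2 is 2 at x =
      1.\<close>
    also have "\<dots> = 0"
      unfolding sum cert_even by simp
    finally show ?thesis by (simp add: add_eq_0_iff2)
  qed
  have main: "bailey_sum b q n + bailey_sum (- b) q n = 2 * U2 b q n" for n
  proof (induction n)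
    case 0
    \<comment> \<open>The case n = 0 is 1/(1 - b) + 1/(1 + b) = 2/(1 - b^2).\<close>
    have "1 - b\<^sup>2 = (1 - b) * (1 - (- b))" by (simp add: algebra_simps power2_eq_square)
    then show ?case
      using assms(4,5) one
      by (simp add: bailey_sum_def U2_def V_def bailey_coeff_def qpoch_def divide_simps)
        (simp add: algebra_simps power2_eq_square)
  next
    case (Suc n)
    define M where "M = (q ^ Suc n)\<^sup>2"
    define D where "D = (q + M) * (1 + M) * (1 - b\<^sup>2 * M)"
    have M: "M = q * (q * q ^ (2 * n))"
      unfolding M_def by (simp add: power_mult_distrib mult.commute[of 2 n] power_mult power2_eq_square)
    \<comment> \<open>To cancel the leading coefficient \<open>D\<close>, note that its factors are,
      up to a factor q, the new denominator factors of \<open>U2 b q (Suc n)\<close>.\<close>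
    have "1 + q ^ (2 * n) * q \<noteq> 0" "1 + M \<noteq> 0"
      using mq[of "2 * Suc n"] by (simp_all add: qpoch_Suc M mult_ac)
    moreover have "q + M = q * (1 + q ^ (2 * n) * q)"
      by (simp add: M algebra_simps)
    moreover have "1 - b\<^sup>2 * M \<noteq> 0"
      using assms(10)[of "Suc n"]
      by (simp add: qpoch_Suc[of _ _ "Suc n"] M_def mult.commute flip: power_mult del: power_Suc)
    ultimately have "D \<noteq> 0" using q by (simp add: D_def)
    moreover have "D * (bailey_sum b q (Suc n) + bailey_sum (- b) q (Suc n)) = D * (2 * U2 b q (Suc n))"
      using rec[OF M_def] U2_Suc[OF q mq assms(10), of n] Suc.IH
      unfolding M_def[symmetric] D_def[symmetric] by (simp add: mult.left_commute[of _ 2])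
    ultimately show ?case by simp
  qed
  show ?thesis
    unfolding bailey_pair_def
  proof
    fix n
    have "U1 b q j / (qpoch (q\<^sup>2) (q\<^sup>2) (n - j) * qpoch (q\<^sup>2 * q\<^sup>2) (q\<^sup>2) (n + j))
      = ((1 - q ^ (4 * j + 2)) * bailey_coeff (q\<^sup>2) n j * V b q j
        + (1 - q ^ (4 * j + 2)) * bailey_coeff (q\<^sup>2) n j * V (- b) q j) / 2" for j
    proof -
      have "qpoch (q\<^sup>2) (q\<^sup>2) (n + 1 + j) = (1 - q\<^sup>2) * qpoch (q\<^sup>2 * q\<^sup>2) (q\<^sup>2) (n + j)"
        by (simp add: qpoch_Suc_shift)
      then show ?thesis
        by (simp add: U1_def U_eq_V bailey_coeff_def add_divide_distrib mult_ac
            del: right_diff_distrib_numeral)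
    qed
    then have "(\<Sum>j=0..n. U1 b q j / (qpoch (q\<^sup>2) (q\<^sup>2) (n - j) * qpoch (q\<^sup>2 * q\<^sup>2) (q\<^sup>2) (n + j)))
        = (bailey_sum b q n + bailey_sum (- b) q n) / 2"
      by (simp only: bailey_sum_def atLeast0AtMost sum.distrib flip: sum_divide_distrib)
    then show "U2 b q n = (\<Sum>j=0..n. U1 b q j / (qpoch (q\<^sup>2) (q\<^sup>2) (n - j)
        * qpoch (q\<^sup>2 * q\<^sup>2) (q\<^sup>2) (n + j)))"
      by (simp add: main)
  qed
qed

end
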